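(* Let $K(a_{n,k})$ be a Köthe space, let $\beta$ be a non-negative increasing sequence tending to infinity, and let $\theta=(\theta_n)_{n\in\mathbb{N}_0}\in\Lambda_\infty(\beta)$. If there exist $m_0\in\mathbb{N}$ and $C>0$ such that $a_{n,m_0}\geq C$ for all $n\in\mathbb{N}$, then the Hankel operator $H_\theta:K(a_{n,k})\to\Lambda_\infty(\beta)$ is well-defined, continuous and compact.
   Context: $\mathbb{N}=\{1,2,\dots\}$, $\mathbb{N}_0=\mathbb{N}\cup\{0\}$. A Köthe matrix is a matrix $(a_{n,k})_{n,k\in\mathbb{N}}$ of non-negative numbers such that for each $n$ there is $k$ with $a_{n,k}>0$, and $a_{n,k}\le a_{n,k+1}$ for all $n,k$. The associated Köthe space is the Fréchet space $K(a_{n,k})=\{x=(x_n)_{n\in\mathbb{N}}:\ \|x\|_k:=\sum_{n=1}^\infty|x_n|a_{n,k}<\infty\ \text{for all }k\in\mathbb{N}\}$ with seminorms $\|\cdot\|_k$, $k\in\mathbb{N}$. For a non-negative increasing sequence $\beta=(\beta_n)_{n\in\mathbb{N}}$ with $\beta_n\to\infty$, the power series space of infinite type is $\Lambda_\infty(\beta)=K(e^{k\beta_n})$, i.e. $\|x\|_k=\sum_{n=1}^\infty|x_n|e^{k\beta_n}$. The sequence $e_n$ has $1$ in the $n$-th place and $0$ elsewhere. A sequence $\theta=(\theta_n)_{n\in\mathbb{N}_0}$ is identified with the sequence $(\theta_{n-1})_{n\in\mathbb{N}}=(\theta_0,\theta_1,\theta_2,\dots)$ when it is said to belong to a sequence space.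 The Hankel operator $H_\theta$ from a Köthe space $E$ to a Köthe space $F$ is given by $H_\theta e_n=(\theta_{n-1},\theta_n,\theta_{n+1},\dots)=\sum_{j=1}^\infty\theta_{j+n-2}e_j$ for $n\in\mathbb{N}$ and $H_\theta x=\sum_{n=1}^\infty x_nH_\theta e_n$ for $x=(x_n)\in E$. It is well-defined if $H_\theta e_n\in F$ for all $n$ and the series $\sum_n x_nH_\theta e_n$ converges in $F$ for every $x\in E$. A linear map $T:E\to F$ between Fréchet spaces is compact if $T(U)$ is precompact in $F$ for some neighborhood $U$ of zero in $E$. *)

theory Defs
  imports "HOL-Analysis.Analysis"
begin

text \<open>
  All index sets are shifted to start at 0: \<open>a n k\<close> stands for \<open>a_(n+1,k+1)\<close>, \<open>x n\<close> for
  the coordinate \<open>x_(n+1)\<close>, \<open>\<beta> n\<close> for \<open>\<beta>_(n+1)\<close>, and seminorm number \<open>k\<close> below is the one usually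
  numbered \<open>k+1\<close>. A sequence \<open>\<theta>\<close> that is indexed by the non-negative integers from the start is not
  shifted; its usual identification with a sequence indexed by the positive integers is then the
  identity.

  The scalar field is any \<^typ>\<open>'a::{real_normed_field,heine_borel}\<close>, which covers both
  \<^typ>\<open>real\<close> and \<^typ>\<open>complex\<close>.
\<close>

definition kothe_matrix :: "(nat \<Rightarrow> nat \<Rightarrow> real) \<Rightarrow> bool" where
  "kothe_matrix a \<longleftrightarrow>
     (\<forall>n k. 0 \<le> a n k) \<and> (\<forall>n. \<exists>k. 0 < a n k) \<and> (\<forall>n k. a n k \<le> a n (Suc k))"

definition kothe_space ::
    "(nat \<Rightarrow> nat \<Rightarrow> real) \<Rightarrow> (nat \<Rightarrow> 'a::{real_normed_field,heine_borel}) set" where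
  "kothe_space a = {x. \<forall>k. summable (\<lambda>n. norm (x n) * a n k)}"

definition kothe_seminorm ::
    "(nat \<Rightarrow> nat \<Rightarrow> real) \<Rightarrow> nat \<Rightarrow> (nat \<Rightarrow> 'a::{real_normed_field,heine_borel}) \<Rightarrow> real" where
  "kothe_seminorm a k x = (\<Sum>n. norm (x n) * a n k)"

definition kothe_ball ::
    "(nat \<Rightarrow> nat \<Rightarrow> real) \<Rightarrow> nat \<Rightarrow> (nat \<Rightarrow> 'a::{real_normed_field,heine_borel}) \<Rightarrow> real
      \<Rightarrow> (nat \<Rightarrow> 'a) set" where
  "kothe_ball a k x r = {y \<in> kothe_space a. kothe_seminorm a k (\<lambda>n. y n - x n) < r}"

definition kothe_topology ::
    "(nat \<Rightarrow> nat \<Rightarrow> real) \<Rightarrow> (nat \<Rightarrow> 'a::{real_normed_field,heine_borel}) topology" where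
  "kothe_topology a =
     topology_generated_by {kothe_ball a k x r | k x r. x \<in> kothe_space a \<and> 0 < r}"

lemma topspace_kothe_topology [simp]: "topspace (kothe_topology a) = kothe_space a"
proof -
  let ?S = "{kothe_ball a k x r | k x r. x \<in> kothe_space a \<and> 0 < r} :: (nat \<Rightarrow> 'a) set set"
  have "\<Union>?S = kothe_space a"
  proof (intro equalityI subsetI)
    fix x :: "nat \<Rightarrow> 'a"
    assume "x \<in> \<Union>?S"
    then show "x \<in> kothe_space a"
      unfolding kothe_ball_def by blast
  next
    fix x :: "nat \<Rightarrow> 'a"
    assume x: "x \<in> kothe_space a"
    then have "x \<in> kothe_ball a 0 x 1"
      by (simp add: kothe_ball_def kothe_seminorm_def)
    moreover have "kothe_ball a 0 x 1 \<in> ?S"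
      using x zero_less_one by blast
    ultimately show "x \<in> \<Union>?S"
      by (rule UnionI[rotated])
  qed
  then show ?thesis
    unfolding kothe_topology_def topology_generated_by_topspace .
qed

text \<open>The matrix of the power series space of infinite type; with the shift of \<open>k\<close>, its entries are
  \<open>exp (k \<beta>_n)\<close> for \<open>k = 1, 2, \<dots>\<close>.\<close>

definition power_series_matrix :: "(nat \<Rightarrow> real) \<Rightarrow> nat \<Rightarrow> nat \<Rightarrow> real" where
  "power_series_matrix \<beta> n k = exp (real (Suc k) * \<beta> n)"

text \<open>The image of the \<open>n\<close>-th unit sequence under the Hankel operator.\<close>

definition hankel_column :: "(nat \<Rightarrow> 'a::{real_normed_field,heine_borel}) \<Rightarrow> nat \<Rightarrow> (nat \<Rightarrow> 'a)" where
  "hankel_column \<theta> n = (\<lambda>j. \<theta> (j + n))"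

definition hankel_partial_sum ::
    "(nat \<Rightarrow> 'a::{real_normed_field,heine_borel}) \<Rightarrow> (nat \<Rightarrow> 'a) \<Rightarrow> nat \<Rightarrow> (nat \<Rightarrow> 'a)" where
  "hankel_partial_sum \<theta> x N = (\<lambda>j. \<Sum>n<N. x n * hankel_column \<theta> n j)"

definition hankel_well_defined ::
    "(nat \<Rightarrow> 'a::{real_normed_field,heine_borel}) \<Rightarrow> (nat \<Rightarrow> nat \<Rightarrow> real) \<Rightarrow> (nat \<Rightarrow> nat \<Rightarrow> real)
      \<Rightarrow> bool" where
  "hankel_well_defined \<theta> a b \<longleftrightarrow>
     (\<forall>n. hankel_column \<theta> n \<in> kothe_space b) \<and>
     (\<forall>x \<in> kothe_space a. \<exists>y. limitin (kothe_topology b) (hankel_partial_sum \<theta> x) y sequentially)"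

text \<open>The sum of the series \<open>\<Sum> x_n H(e_n)\<close> in the target space with matrix \<open>b\<close>, that is, the limit of
  its partial sums in the topology of that space.\<close>

definition hankel ::
    "(nat \<Rightarrow> 'a::{real_normed_field,heine_borel}) \<Rightarrow> (nat \<Rightarrow> nat \<Rightarrow> real) \<Rightarrow> (nat \<Rightarrow> 'a) \<Rightarrow> (nat \<Rightarrow> 'a)"
  where
  "hankel \<theta> b x = (THE y. limitin (kothe_topology b) (hankel_partial_sum \<theta> x) y sequentially)"

definition zero_neighborhood ::
    "(nat \<Rightarrow> 'a::{real_normed_field,heine_borel}) topology \<Rightarrow> (nat \<Rightarrow> 'a) set \<Rightarrow> bool" where
  "zero_neighborhood X U \<longleftrightarrow>
     U \<subseteq> topspace X \<and> (\<exists>V. openin X V \<and> (\<lambda>n. 0) \<in> V \<and> V \<subseteq> U)"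

text \<open>Total boundedness for the translation-invariant uniformity of a topological vector space.\<close>

definition precompact_in ::
    "(nat \<Rightarrow> 'a::{real_normed_field,heine_borel}) topology \<Rightarrow> (nat \<Rightarrow> 'a) set \<Rightarrow> bool" where
  "precompact_in X A \<longleftrightarrow>
     A \<subseteq> topspace X \<and>
     (\<forall>V. zero_neighborhood X V \<longrightarrow>
        (\<exists>B. finite B \<and> B \<subseteq> topspace X \<and> A \<subseteq> (\<Union>b\<in>B. (\<lambda>v n. b n + v n) ` V)))"

definition linear_map_between ::
    "(nat \<Rightarrow> 'a::{real_normed_field,heine_borel}) set \<Rightarrow> (nat \<Rightarrow> 'a) set
      \<Rightarrow> ((nat \<Rightarrow> 'a) \<Rightarrow> (nat \<Rightarrow> 'a)) \<Rightarrow> bool" where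
  "linear_map_between E F T \<longleftrightarrow>
     T \<in> E \<rightarrow> F \<and>
     (\<forall>x\<in>E. \<forall>y\<in>E. T (\<lambda>n. x n + y n) = (\<lambda>n. T x n + T y n)) \<and>
     (\<forall>c. \<forall>x\<in>E. T (\<lambda>n. c * x n) = (\<lambda>n. c * T x n))"

definition compact_operator ::
    "(nat \<Rightarrow> 'a::{real_normed_field,heine_borel}) topology \<Rightarrow> (nat \<Rightarrow> 'a) topology
      \<Rightarrow> ((nat \<Rightarrow> 'a) \<Rightarrow> (nat \<Rightarrow> 'a)) \<Rightarrow> bool" where
  "compact_operator X Y T \<longleftrightarrow>
     linear_map_between (topspace X) (topspace Y) T \<and>
     (\<exists>U. zero_neighborhood X U \<and> precompact_in Y (T ` U))"

end

theory Submission
  imports Defs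
begin

text \<open>
  Since \<open>\<beta>\<close> is increasing, the weights of the target increase along the coordinates, so a
  shifted sequence \<open>(\<theta> (j + n))\<^sub>j\<close> has tails dominated by those of \<open>\<theta>\<close>, uniformly in \<open>n\<close>. Interchanging
  sums, the tail of \<open>H x\<close> beyond \<open>J\<close> has seminorm at most \<open>\<parallel>x\<parallel>\<^sub>1\<close> times that of the tail of \<open>\<theta>\<close>, and
  \<open>\<parallel>x\<parallel>\<^sub>1\<close> is at most \<open>\<parallel>x\<parallel>\<close> in the \<open>m0\<close>-th seminorm divided by \<open>C\<close>. For \<open>J = 0\<close> this is continuity;
  for large \<open>J\<close> it makes the tails uniformly small on a neighborhood of zero, which together with
  boundedness of the coordinates gives precompactness.
\<close>

section \<open>Seminorms and topology of a Koethe space\<close>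

lemma kothe_matrix_nonneg: "kothe_matrix a \<Longrightarrow> 0 \<le> a n k"
  by (simp add: kothe_matrix_def)

lemma kothe_matrix_mono: "kothe_matrix a \<Longrightarrow> k \<le> l \<Longrightarrow> a n k \<le> a n l"
  unfolding kothe_matrix_def by (blast intro: lift_Suc_mono_le[of "a n"])

lemma kothe_space_summable: "x \<in> kothe_space a \<Longrightarrow> summable (\<lambda>n. norm (x n) * a n k)"
  by (simp add: kothe_space_def)

lemma kothe_space_dominated:
  assumes "kothe_matrix a" "y \<in> kothe_space a" "\<And>n. norm (x n) \<le> norm (y n)"
  shows "x \<in> kothe_space a" "kothe_seminorm a k x \<le> kothe_seminorm a k y"
proof -
  have le: "norm (x n) * a n l \<le> norm (y n) * a n l" for n l
    using assms by (intro mult_right_mono kothe_matrix_nonneg)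
  have sm: "summable (\<lambda>n. norm (x n) * a n l)" for l
    by (rule summable_comparison_test'[OF kothe_space_summable[OF assms(2), of l], of 0])
       (use le kothe_matrix_nonneg[OF assms(1)] in \<open>simp add: abs_mult\<close>)
  then show "x \<in> kothe_space a" by (simp add: kothe_space_def)
  show "kothe_seminorm a k x \<le> kothe_seminorm a k y"
    unfolding kothe_seminorm_def
    by (rule suminf_le[OF le sm kothe_space_summable[OF assms(2)]])
qed

lemma kothe_space_scale:
  assumes "x \<in> kothe_space a"
  shows "(\<lambda>n. c * x n) \<in> kothe_space a"
  using assms by (auto simp: kothe_space_def norm_mult mult.assoc intro: summable_mult)

lemma kothe_space_add:
  assumes "kothe_matrix a" "x \<in> kothe_space a" "y \<in> kothe_space a"
  shows "(\<lambda>n. x n + y n) \<in> kothe_space a"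
    "kothe_seminorm a k (\<lambda>n. x n + y n) \<le> kothe_seminorm a k x + kothe_seminorm a k y"
proof -
  have le: "norm (x n + y n) * a n l \<le> norm (x n) * a n l + norm (y n) * a n l" for n l
    using mult_right_mono[OF norm_triangle_ineq[of "x n" "y n"] kothe_matrix_nonneg[OF assms(1), of n l]]
    by (simp add: distrib_right)
  have sm': "summable (\<lambda>n. norm (x n) * a n l + norm (y n) * a n l)" for l
    by (intro summable_add kothe_space_summable assms)
  have sm: "summable (\<lambda>n. norm (x n + y n) * a n l)" for l
    by (rule summable_comparison_test'[OF sm', of 0])
       (use le kothe_matrix_nonneg[OF assms(1)] in \<open>simp add: abs_mult\<close>)
  then show "(\<lambda>n. x n + y n) \<in> kothe_space a" by (simp add: kothe_space_def)
  have "kothe_seminorm a k (\<lambda>n. x n + y n) \<le> (\<Sum>n. norm (x n) * a n k + norm (y n) * a n k)"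
    unfolding kothe_seminorm_def by (rule suminf_le[OF le sm sm'])
  then show "kothe_seminorm a k (\<lambda>n. x n + y n) \<le> kothe_seminorm a k x + kothe_seminorm a k y"
    by (simp add: kothe_seminorm_def suminf_add kothe_space_summable assms)
qed

lemma kothe_space_diff:
  assumes "kothe_matrix a" "x \<in> kothe_space a" "y \<in> kothe_space a"
  shows "(\<lambda>n. x n - y n) \<in> kothe_space a"
  using kothe_space_add(1)[OF assms(1,2) kothe_space_scale[OF assms(3), of "-1"]] by simp

lemma kothe_seminorm_nonneg:
  "kothe_matrix a \<Longrightarrow> x \<in> kothe_space a \<Longrightarrow> 0 \<le> kothe_seminorm a k x"
  unfolding kothe_seminorm_def
  by (intro suminf_nonneg kothe_space_summable) (auto simp: kothe_matrix_nonneg)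

lemma kothe_seminorm_mono:
  "kothe_matrix a \<Longrightarrow> x \<in> kothe_space a \<Longrightarrow> k \<le> l \<Longrightarrow> kothe_seminorm a k x \<le> kothe_seminorm a l x"
  unfolding kothe_seminorm_def
  by (intro suminf_le kothe_space_summable) (auto intro: mult_left_mono kothe_matrix_mono)

lemma kothe_seminorm_minus_commute:
  "kothe_seminorm a k (\<lambda>n. x n - y n) = kothe_seminorm a k (\<lambda>n. y n - x n)"
  by (simp add: kothe_seminorm_def norm_minus_commute)

lemma kothe_seminorm_triangle:
  assumes "kothe_matrix a" "x \<in> kothe_space a" "y \<in> kothe_space a" "z \<in> kothe_space a"
  shows "kothe_seminorm a k (\<lambda>n. x n - z n)
    \<le> kothe_seminorm a k (\<lambda>n. x n - y n) + kothe_seminorm a k (\<lambda>n. y n - z n)"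
  using kothe_space_add(2)[OF assms(1) kothe_space_diff[OF assms(1-3)] kothe_space_diff[OF assms(1,3,4)], of k]
  by simp

lemma zero_in_kothe_space [simp]: "(\<lambda>n. 0) \<in> kothe_space a"
  by (simp add: kothe_space_def)

lemma kothe_seminorm_zero [simp]: "kothe_seminorm a k (\<lambda>n. 0) = 0"
  by (simp add: kothe_seminorm_def)

lemma kothe_space_finite_support:
  assumes "\<And>n. n \<ge> J \<Longrightarrow> x n = 0"
  shows "x \<in> kothe_space a" "kothe_seminorm a k x = (\<Sum>n<J. norm (x n) * a n k)"
proof -
  have "(\<lambda>n. norm (x n) * a n l) sums (\<Sum>n<J. norm (x n) * a n l)" for l
    by (rule sums_finite) (auto simp: assms)
  then show "x \<in> kothe_space a" "kothe_seminorm a k x = (\<Sum>n<J. norm (x n) * a n k)"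
    by (auto simp: kothe_space_def kothe_seminorm_def sums_iff)
qed

section \<open>Balls as a neighborhood basis, limits and continuity\<close>

lemma openin_kothe_ball:
  "x \<in> kothe_space a \<Longrightarrow> 0 < r \<Longrightarrow> openin (kothe_topology a) (kothe_ball a k x r)"
  unfolding kothe_topology_def by (rule topology_generated_by_Basis) blast

lemma center_in_kothe_ball: "x \<in> kothe_space a \<Longrightarrow> 0 < r \<Longrightarrow> x \<in> kothe_ball a k x r"
  by (simp add: kothe_ball_def)

text \<open>By definition the balls only form a subbasis. They form a neighborhood basis because the
  seminorms increase with the index: two balls around the same point contain a third one with the
  larger index and the smaller radius. Later statements on limits, continuity and precompactness
  thus reduce to single seminorms.\<close>

lemma openin_kothe_contains_ball:
  fixes U :: "(nat \<Rightarrow> 'a::{real_normed_field,heine_borel}) set"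
  assumes a: "kothe_matrix a" and U: "openin (kothe_topology a) U" and x: "x \<in> U"
  obtains k r where "0 < r" "kothe_ball a k x r \<subseteq> U"
proof -
  let ?S = "{kothe_ball a k x r | k x r. x \<in> kothe_space a \<and> 0 < r} :: (nat \<Rightarrow> 'a) set set"
  have "generate_topology_on ?S U"
    using U unfolding kothe_topology_def by (rule openin_topology_generated_by)
  then have "\<forall>x\<in>U. \<exists>k r. 0 < r \<and> kothe_ball a k x r \<subseteq> U"
  proof induction
    case Empty
    then show ?case by simp
  next
    case (Int V W)
    show ?case
    proof
      fix x assume "x \<in> V \<inter> W"
      with Int.IH obtain k r l s where *: "0 < r" "kothe_ball a k x r \<subseteq> V" "0 < s" "kothe_ball a l x s \<subseteq> W"
        by (meson IntE)
      \<comment> \<open>The center has to lie in the space so that differences with it do too: only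
        then are their seminorms sums of convergent series, hence comparable for different
        indices.\<close>
      have "x \<in> kothe_space a"
      proof -
        have "openin (kothe_topology a) V"
          using Int.hyps by (simp add: kothe_topology_def openin_topology_generated_by_iff)
        then show ?thesis using \<open>x \<in> V \<inter> W\<close> openin_subset by fastforce
      qed
      then have "kothe_ball a (max k l) x (min r s) \<subseteq> kothe_ball a k x r \<inter> kothe_ball a l x s"
        using kothe_seminorm_mono[OF a kothe_space_diff[OF a _ \<open>x \<in> kothe_space a\<close>], of _ k "max k l"]
          kothe_seminorm_mono[OF a kothe_space_diff[OF a _ \<open>x \<in> kothe_space a\<close>], of _ l "max k l"]
        by (auto simp: kothe_ball_def intro: le_less_trans)
      then show "\<exists>k r. 0 < r \<and> kothe_ball a k x r \<subseteq> V \<inter> W"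
        using * by (intro exI[of _ "max k l"] exI[of _ "min r s"]) auto
    qed
  next
    case (UN K)
    show ?case
    proof
      fix x assume "x \<in> \<Union>K"
      then obtain V where V: "V \<in> K" "x \<in> V" by blast
      with UN.IH obtain k r where "0 < r" "kothe_ball a k x r \<subseteq> V" by blast
      with V(1) show "\<exists>k r. 0 < r \<and> kothe_ball a k x r \<subseteq> \<Union>K" by blast
    qed
  next
    case (Basis W)
    then obtain k c r where W: "W = kothe_ball a k c r" and c: "c \<in> kothe_space a" by blast
    show ?case
    proof
      fix x assume "x \<in> W"
      then have x: "x \<in> kothe_space a" "kothe_seminorm a k (\<lambda>n. x n - c n) < r"
        by (auto simp: W kothe_ball_def)
      have "kothe_ball a k x (r - kothe_seminorm a k (\<lambda>n. x n - c n)) \<subseteq> W"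
      proof
        fix y assume "y \<in> kothe_ball a k x (r - kothe_seminorm a k (\<lambda>n. x n - c n))"
        then show "y \<in> W"
          using kothe_seminorm_triangle[OF a _ x(1) c, of y k] by (auto simp: W kothe_ball_def)
      qed
      then show "\<exists>k r. 0 < r \<and> kothe_ball a k x r \<subseteq> W"
        using x(2) by (intro exI conjI) auto
    qed
  qed
  then show ?thesis using x that by blast
qed

lemma limitin_kothe_topology:
  assumes a: "kothe_matrix a" and f: "\<And>n. f n \<in> kothe_space a"
  shows "limitin (kothe_topology a) f y sequentially \<longleftrightarrow>
    y \<in> kothe_space a \<and> (\<forall>k. (\<lambda>n. kothe_seminorm a k (\<lambda>i. f n i - y i)) \<longlonglongrightarrow> 0)"
    (is "?L \<longleftrightarrow> ?R")
proof
  assume L: ?L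
  then have y: "y \<in> kothe_space a" by (simp add: limitin_def)
  have "(\<lambda>n. kothe_seminorm a k (\<lambda>i. f n i - y i)) \<longlonglongrightarrow> 0" for k
  proof (rule tendstoI)
    fix e :: real assume "0 < e"
    then have "eventually (\<lambda>n. f n \<in> kothe_ball a k y e) sequentially"
      using L openin_kothe_ball[OF y] center_in_kothe_ball[OF y] by (simp add: limitin_def)
    then show "eventually (\<lambda>n. dist (kothe_seminorm a k (\<lambda>i. f n i - y i)) 0 < e) sequentially"
      by eventually_elim
         (use kothe_seminorm_nonneg[OF a kothe_space_diff[OF a f y]] in \<open>simp add: kothe_ball_def\<close>)
  qed
  with y show ?R by blast
next
  assume R: ?R
  show ?L
    unfolding limitin_def
  proof (intro conjI allI impI)
    show "y \<in> topspace (kothe_topology a)" using R by simp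
    fix U assume "openin (kothe_topology a) U \<and> y \<in> U"
    then obtain k r where kr: "0 < r" "kothe_ball a k y r \<subseteq> U"
      using openin_kothe_contains_ball[OF a] by blast
    have "eventually (\<lambda>n. kothe_seminorm a k (\<lambda>i. f n i - y i) < r) sequentially"
      using R kr(1) by (auto intro: order_tendstoD)
    then show "eventually (\<lambda>n. f n \<in> U) sequentially"
      by eventually_elim (use kr f in \<open>auto simp: kothe_ball_def\<close>)
  qed
qed

text \<open>The seminorms separate points because every row of a Koethe matrix has a positive
  entry.\<close>

lemma kothe_seminorm_eq_0_imp:
  assumes a: "kothe_matrix a" and x: "x \<in> kothe_space a" and "\<And>k. kothe_seminorm a k x = 0"
  shows "x n = 0"
proof -
  obtain k where k: "0 < a n k" using a unfolding kothe_matrix_def by blast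
  have "norm (x n) * a n k = 0"
    using suminf_eq_zero_iff[OF kothe_space_summable[OF x, of k]] assms(3)[of k] kothe_matrix_nonneg[OF a]
    by (simp add: kothe_seminorm_def)
  with k show ?thesis by simp
qed

text \<open>Needed to evaluate the definite description in \<open>hankel\<close>.\<close>

lemma limitin_kothe_topology_unique:
  assumes a: "kothe_matrix a" and f: "\<And>n. f n \<in> kothe_space a"
    and "limitin (kothe_topology a) f y sequentially" "limitin (kothe_topology a) f z sequentially"
  shows "y = z"
proof -
  note lim = assms(3,4)[unfolded limitin_kothe_topology[OF a f]]
  have yz: "y \<in> kothe_space a" "z \<in> kothe_space a" using lim by auto
  have "kothe_seminorm a k (\<lambda>i. y i - z i) = 0" for k
  proof (rule antisym)
    have "(\<lambda>n. kothe_seminorm a k (\<lambda>i. f n i - y i) + kothe_seminorm a k (\<lambda>i. f n i - z i)) \<longlonglongrightarrow> 0 + 0"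
      using lim by (intro tendsto_add) auto
    moreover have "kothe_seminorm a k (\<lambda>i. y i - z i) \<le>
        kothe_seminorm a k (\<lambda>i. f n i - y i) + kothe_seminorm a k (\<lambda>i. f n i - z i)" for n
      using kothe_seminorm_triangle[OF a yz(1) f yz(2), of k n]
      by (simp add: kothe_seminorm_minus_commute[of a k y])
    ultimately show "kothe_seminorm a k (\<lambda>i. y i - z i) \<le> 0"
      by (auto intro: LIMSEQ_le_const)
  qed (rule kothe_seminorm_nonneg[OF a kothe_space_diff[OF a yz]])
  from kothe_seminorm_eq_0_imp[OF a kothe_space_diff[OF a yz] this] show ?thesis
    by (simp add: fun_eq_iff)
qed

lemma linear_map_between_diff:
  assumes "linear_map_between (kothe_space a) F T" "x \<in> kothe_space a" "y \<in> kothe_space a"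
  shows "T (\<lambda>n. x n - y n) = (\<lambda>n. T x n - T y n)"
proof -
  have add: "T (\<lambda>n. u n + v n) = (\<lambda>n. T u n + T v n)"
    if "u \<in> kothe_space a" "v \<in> kothe_space a" for u v
    using assms(1) that unfolding linear_map_between_def by blast
  have "T (\<lambda>n. (-1) * y n) = (\<lambda>n. (-1) * T y n)"
    using assms(1,3) unfolding linear_map_between_def by blast
  with add[OF assms(2) kothe_space_scale[OF assms(3), of "-1"]] show ?thesis by simp
qed

text \<open>Linearity carries the seminorm estimate at zero over to differences, hence to every
  point.\<close>

lemma continuous_map_kothe:
  fixes T :: "(nat \<Rightarrow> 'a::{real_normed_field,heine_borel}) \<Rightarrow> (nat \<Rightarrow> 'a)"
  assumes a: "kothe_matrix a" and b: "kothe_matrix b"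
    and T: "linear_map_between (kothe_space a) (kothe_space b) T"
    and bound: "\<And>k. \<exists>l M. \<forall>x\<in>kothe_space a. kothe_seminorm b k (T x) \<le> M * kothe_seminorm a l x"
  shows "continuous_map (kothe_topology a) (kothe_topology b) T"
proof -
  have TF: "T x \<in> kothe_space b" if "x \<in> kothe_space a" for x
    using T that by (auto simp: linear_map_between_def)
  have "openin (kothe_topology a) {x \<in> kothe_space a. T x \<in> U}"
    if U: "openin (kothe_topology b) U" for U
  proof (subst openin_subopen, safe)
    fix x assume x: "x \<in> kothe_space a" "T x \<in> U"
    obtain k r where r: "0 < r" "kothe_ball b k (T x) r \<subseteq> U"
      using openin_kothe_contains_ball[OF b U x(2)] by blast
    obtain l M where M: "\<And>x. x \<in> kothe_space a \<Longrightarrow> kothe_seminorm b k (T x) \<le> M * kothe_seminorm a l x"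
      using bound[of k] by blast
    \<comment> \<open>The hypothesis allows \<open>M\<close> to be zero or negative; the denominator
      is positive in every case.\<close>
    define s where "s = r / (\<bar>M\<bar> + 1)"
    have s: "0 < s" using r by (simp add: s_def)
    have "T y \<in> U" if y: "y \<in> kothe_ball a l x s" for y
    proof -
      have y': "y \<in> kothe_space a" "kothe_seminorm a l (\<lambda>n. y n - x n) < s"
        using y by (auto simp: kothe_ball_def)
      let ?d = "\<lambda>n. y n - x n"
      have d: "?d \<in> kothe_space a" by (rule kothe_space_diff[OF a y'(1) x(1)])
      have "kothe_seminorm b k (T ?d) \<le> M * kothe_seminorm a l ?d" by (rule M[OF d])
      also have "\<dots> \<le> (\<bar>M\<bar> + 1) * kothe_seminorm a l ?d"
        using kothe_seminorm_nonneg[OF a d, of l] by (intro mult_right_mono) auto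
      also have "\<dots> < (\<bar>M\<bar> + 1) * s"
        using y'(2) by (intro mult_strict_left_mono) auto
      also have "\<dots> = r" by (simp add: s_def field_simps)
      finally show ?thesis
        using r(2) TF[OF y'(1)] by (auto simp: kothe_ball_def linear_map_between_diff[OF T y'(1) x(1)])
    qed
    moreover have "kothe_ball a l x s \<subseteq> kothe_space a" by (auto simp: kothe_ball_def)
    ultimately show "\<exists>V. openin (kothe_topology a) V \<and> x \<in> V \<and> V \<subseteq> {x \<in> kothe_space a. T x \<in> U}"
      using openin_kothe_ball[OF x(1) s, of l] center_in_kothe_ball[OF x(1) s, of l] by blast
  qed
  then show ?thesis using TF by (simp add: continuous_map_def Pi_def)
qed

section \<open>Tails and precompactness\<close>

text \<open>The first entries are set to zero and not dropped, so each remaining entry keeps its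
  index and hence its weight.\<close>

definition seq_tail :: "nat \<Rightarrow> (nat \<Rightarrow> 'a::zero) \<Rightarrow> nat \<Rightarrow> 'a" where
  "seq_tail J x = (\<lambda>j. if j < J then 0 else x j)"

lemma seq_tail_0 [simp]: "seq_tail 0 x = x"
  by (simp add: seq_tail_def)

lemma seq_tail_in_kothe_space:
  "kothe_matrix a \<Longrightarrow> x \<in> kothe_space a \<Longrightarrow> seq_tail J x \<in> kothe_space a"
  by (rule kothe_space_dominated(1)) (auto simp: seq_tail_def)

text \<open>The seminorm of the tail is the remainder of the convergent series that defines the
  seminorm of \<open>x\<close>.\<close>

lemma kothe_seminorm_seq_tail_tendsto_0:
  assumes "kothe_matrix a" "x \<in> kothe_space a"
  shows "(\<lambda>J. kothe_seminorm a k (seq_tail J x)) \<longlonglongrightarrow> 0"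
proof -
  let ?f = "\<lambda>n. norm (x n) * a n k"
  have eq: "kothe_seminorm a k (seq_tail J x) = suminf ?f - sum ?f {..<J}" for J
  proof -
    have "(\<Sum>n. norm (seq_tail J x n) * a n k) = (\<Sum>n. norm (seq_tail J x (n + J)) * a (n + J) k)"
      by (subst suminf_split_initial_segment[of _ J])
         (auto simp: seq_tail_def intro!: kothe_space_summable seq_tail_in_kothe_space[unfolded seq_tail_def] assms)
    also have "\<dots> = (\<Sum>n. ?f (n + J))"
      by (simp add: seq_tail_def)
    also have "\<dots> = suminf ?f - sum ?f {..<J}"
      by (intro suminf_minus_initial_segment kothe_space_summable assms)
    finally show ?thesis by (simp add: kothe_seminorm_def)
  qed
  have "(\<lambda>J. suminf ?f - sum ?f {..<J}) \<longlonglongrightarrow> suminf ?f - suminf ?f"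
    by (intro tendsto_intros summable_LIMSEQ kothe_space_summable assms)
  then show ?thesis by (simp add: eq)
qed

text \<open>A compactness criterion of Frechet-Kolmogorov type. Uniformly small tails reduce the
  question to finitely many coordinates, and in each of these the bounded set of values has a finite
  net by the Heine-Borel property of the scalars.\<close>

lemma precompact_in_kothe:
  fixes A :: "(nat \<Rightarrow> 'a::{real_normed_field,heine_borel}) set"
  assumes b: "kothe_matrix b" and A: "A \<subseteq> kothe_space b"
    and bdd: "\<And>j. \<exists>R. \<forall>y\<in>A. norm (y j) \<le> R"
    and tails: "\<And>k e. 0 < e \<Longrightarrow> \<exists>J. \<forall>y\<in>A. kothe_seminorm b k (seq_tail J y) < e"
  shows "precompact_in (kothe_topology b) A"
  unfolding precompact_in_def
proof (intro conjI allI impI)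
  show "A \<subseteq> topspace (kothe_topology b)" using A by simp
  fix V :: "(nat \<Rightarrow> 'a) set"
  assume "zero_neighborhood (kothe_topology b) V"
  then obtain W where W: "openin (kothe_topology b) W" "(\<lambda>n. 0) \<in> W" "W \<subseteq> V"
    by (auto simp: zero_neighborhood_def)
  obtain k r where r: "0 < r" "kothe_ball b k (\<lambda>n. 0) r \<subseteq> W"
    using openin_kothe_contains_ball[OF b W(1,2)] by blast
  obtain J where J: "\<And>y. y \<in> A \<Longrightarrow> kothe_seminorm b k (seq_tail J y) < r / 2"
    using tails[of "r / 2" k] r by auto
  define s where "s = (\<Sum>j<J. b j k)"
  have s: "0 \<le> s" unfolding s_def by (intro sum_nonneg kothe_matrix_nonneg b)
  \<comment> \<open>An error of at most \<open>d\<close> in each of the first \<open>J\<close>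
    coordinates costs at most \<open>d * s\<close>, which is at most \<open>r / 2\<close>. Adding 1
    keeps the denominator positive when all these weights vanish.\<close>
  define d where "d = r / 2 / (s + 1)"
  have d: "0 < d" using r s by (simp add: d_def)
  obtain R where R: "\<And>j y. y \<in> A \<Longrightarrow> norm (y j) \<le> R j" using bdd by metis
  have "\<exists>F. finite F \<and> cball 0 (R j) \<subseteq> (\<Union>c\<in>F. ball (c::'a) d)" for j
    using compact_cball[of "0::'a" "R j"] d unfolding compact_eq_totally_bounded by blast
  then obtain F where F: "\<And>j. finite (F j)" "\<And>j. cball (0::'a) (R j) \<subseteq> (\<Union>c\<in>F j. ball c d)"
    by metis
  \<comment> \<open>All combinations of net points in the first \<open>J\<close> coordinates,
    continued by zero; finite support puts them into the space.\<close>
  define B where "B = (\<lambda>c n. if n < J then c n else 0) ` PiE {..<J} F"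
  have "A \<subseteq> (\<Union>c\<in>B. (\<lambda>v n. c n + v n) ` V)"
  proof
    fix y assume y: "y \<in> A"
    have "\<exists>c. c \<in> F j \<and> dist c (y j) < d" for j
      using F(2)[of j] R[OF y, of j] by (auto simp: subset_iff)
    then obtain g where g: "\<And>j. g j \<in> F j" "\<And>j. dist (g j) (y j) < d" by metis
    define c where "c n = (if n < J then g n else 0)" for n
    have cB: "c \<in> B"
      \<comment> \<open>Members of \<open>PiE\<close> are undefined off the index set, hence the
        restriction of \<open>g\<close>; only its values below \<open>J\<close> matter.\<close>
      unfolding B_def by (rule image_eqI[of _ _ "restrict g {..<J}"]) (use g(1) in \<open>auto simp: c_def\<close>)
    define h where "h n = (if n < J then y n - c n else 0)" for n
    \<comment> \<open>Since \<open>c\<close> vanishes from \<open>J\<close> on, the error is a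
      finite head plus the tail of \<open>y\<close>; each contributes at most \<open>r / 2\<close>,
      the tail strictly less.\<close>
    have eq: "(\<lambda>n. y n - c n) = (\<lambda>n. h n + seq_tail J y n)"
      by (auto simp: h_def c_def seq_tail_def)
    have h: "h \<in> kothe_space b" "kothe_seminorm b k h = (\<Sum>j<J. norm (h j) * b j k)"
      using kothe_space_finite_support[of J h] by (auto simp: h_def)
    have "kothe_seminorm b k h \<le> (\<Sum>j<J. d * b j k)"
      unfolding h(2)
    proof (intro sum_mono mult_right_mono kothe_matrix_nonneg[OF b])
      fix j assume "j \<in> {..<J}"
      then show "norm (h j) \<le> d"
        using g(2)[of j] by (simp add: h_def c_def dist_norm norm_minus_commute)
    qed
    also have "\<dots> = d * s" by (simp add: s_def sum_distrib_left)
    also have "\<dots> \<le> r / 2"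
      using r s by (simp add: d_def field_simps)
    finally have "kothe_seminorm b k (\<lambda>n. y n - c n) < r"
      unfolding eq
      using kothe_space_add(2)[OF b h(1) seq_tail_in_kothe_space[OF b], of y k J] J[OF y] A y by force
    moreover have "(\<lambda>n. y n - c n) \<in> kothe_space b"
      unfolding eq using h(1) seq_tail_in_kothe_space[OF b] A y by (intro kothe_space_add b) auto
    ultimately have "(\<lambda>n. y n - c n) \<in> V"
      using r(2) W(3) by (auto simp: kothe_ball_def)
    then show "y \<in> (\<Union>c\<in>B. (\<lambda>v n. c n + v n) ` V)"
      using cB by (intro UN_I[of c] image_eqI[of _ _ "\<lambda>n. y n - c n"]) auto
  qed
  moreover have "finite B" unfolding B_def by (intro finite_imageI finite_PiE F) auto
  moreover have "B \<subseteq> topspace (kothe_topology b)"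
    unfolding B_def topspace_kothe_topology
    by (intro image_subsetI kothe_space_finite_support(1)[of J]) simp
  ultimately show "\<exists>B. finite B \<and> B \<subseteq> topspace (kothe_topology b) \<and> A \<subseteq> (\<Union>c\<in>B. (\<lambda>v n. c n + v n) ` V)"
    by (intro exI[of _ B] conjI)
qed

section \<open>The Hankel operator on absolutely summable sequences\<close>

text \<open>The library states these facts only for the class \<open>banach\<close>, which the sort
  \<open>{real_normed_field, heine_borel}\<close> does not syntactically entail.\<close>

lemma summable_norm_le_heine_borel:
  fixes f :: "nat \<Rightarrow> 'a::{real_normed_field,heine_borel}"
  assumes le: "\<And>n. norm (f n) \<le> g n" and g: "summable g"
  shows "summable f" "norm (suminf f) \<le> suminf g"
proof -
  have "Cauchy (\<lambda>n. sum f {..<n})"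
  proof (rule metric_CauchyI)
    fix e :: real assume "0 < e"
    then obtain N where N: "\<And>m n. m \<ge> N \<Longrightarrow> norm (sum g {m..<n}) < e"
      using g unfolding summable_Cauchy by blast
    have le_e: "norm (sum f {m..<n}) < e" if "m \<ge> N" for m n
      using N[OF that, of n] sum_norm_le[of "{m..<n}" f g] le by force
    have *: "dist (sum f {..<m}) (sum f {..<n}) < e" if "m \<ge> N" "m \<le> n" for m n
      using le_e[OF that(1), of n] sum_diff_nat_ivl[of 0 m n f] that(2)
      by (metis dist_norm dist_commute lessThan_atLeast0 le0)
    have "dist (sum f {..<m}) (sum f {..<n}) < e" if "m \<ge> N" "n \<ge> N" for m n
      using *[of m n] *[of n m] that by (metis dist_commute nle_le)
    then show "\<exists>M. \<forall>m\<ge>M. \<forall>n\<ge>M. dist (sum f {..<m}) (sum f {..<n}) < e" by blast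
  qed
  \<comment> \<open>Heine-Borel spaces are complete, so the Cauchy partial sums converge.\<close>
  then show sm: "summable f"
    by (simp add: Cauchy_convergent_iff summable_iff_convergent)
  show "norm (suminf f) \<le> suminf g"
    by (rule LIMSEQ_le[OF tendsto_norm[OF summable_LIMSEQ[OF sm]] summable_LIMSEQ[OF g]])
       (use le in \<open>auto intro: sum_norm_le\<close>)
qed

text \<open>With constant weight 1 the Koethe space is ell^1 and every seminorm is the ell^1 norm,
  so the general lemmas on sums and tails apply to it.\<close>

abbreviation ell1_matrix :: "nat \<Rightarrow> nat \<Rightarrow> real" where
  "ell1_matrix \<equiv> \<lambda>_ _. 1"

lemma kothe_matrix_ell1: "kothe_matrix ell1_matrix"
  by (simp add: kothe_matrix_def)

text \<open>The lower bound on column \<open>m\<close> makes the inclusion of K(a) in ell^1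
  continuous, which lets the Hankel operator be studied on ell^1.\<close>

lemma kothe_space_subset_ell1:
  assumes x: "x \<in> kothe_space a" and C: "0 < C" "\<And>n. C \<le> a n m"
  shows "x \<in> kothe_space ell1_matrix" "kothe_seminorm ell1_matrix 0 x \<le> kothe_seminorm a m x / C"
proof -
  have le: "norm (x n) \<le> norm (x n) * a n m / C" for n
    using C mult_left_mono[OF C(2), of "norm (x n)" n] by (simp add: field_simps)
  have sm: "summable (\<lambda>n. norm (x n) * a n m / C)"
    by (intro summable_divide kothe_space_summable x)
  have sm1: "summable (\<lambda>n. norm (x n))"
    by (rule summable_comparison_test'[OF sm, of 0]) (use le in auto)
  then show "x \<in> kothe_space ell1_matrix" by (simp add: kothe_space_def)
  have "(\<Sum>n. norm (x n)) \<le> (\<Sum>n. norm (x n) * a n m / C)" by (rule suminf_le[OF le sm1 sm])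
  also have "\<dots> = kothe_seminorm a m x / C"
    by (simp add: kothe_seminorm_def suminf_divide kothe_space_summable x)
  finally show "kothe_seminorm ell1_matrix 0 x \<le> kothe_seminorm a m x / C"
    by (simp add: kothe_seminorm_def)
qed

text \<open>The coordinatewise candidate for the limit that \<open>hankel\<close> describes;
  \<open>hankel_eq_apply\<close> identifies the two.\<close>

definition hankel_apply ::
    "(nat \<Rightarrow> 'a::{real_normed_field,heine_borel}) \<Rightarrow> (nat \<Rightarrow> 'a) \<Rightarrow> nat \<Rightarrow> 'a" where
  "hankel_apply \<theta> x = (\<lambda>j. \<Sum>n. x n * \<theta> (j + n))"

text \<open>The argument is carried out for any target whose weights increase along the coordinates;
  power series matrices are an instance.\<close>

locale hankel_ell1 =
  fixes b :: "nat \<Rightarrow> nat \<Rightarrow> real" and \<theta> :: "nat \<Rightarrow> 'a::{real_normed_field,heine_borel}"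
  assumes b: "kothe_matrix b" and b_incseq: "\<And>k. incseq (\<lambda>n. b n k)"
    and \<theta>: "\<theta> \<in> kothe_space b"
begin

text \<open>Raising the weight from index \<open>j\<close> to \<open>j + n\<close> turns the left
  side into a partial sum of the series for \<open>y\<close>. The bound depends neither on
  \<open>n\<close> nor on \<open>L\<close>: it is uniform over the columns, and it yields
  summability through bounded partial sums.\<close>

lemma sum_shift_le:
  assumes "y \<in> kothe_space b"
  shows "(\<Sum>j<L. norm (y (j + n)) * b j k) \<le> kothe_seminorm b k y"
proof -
  have "(\<Sum>j<L. norm (y (j + n)) * b j k) \<le> (\<Sum>j<L. norm (y (j + n)) * b (j + n) k)"
    using b_incseq by (intro sum_mono mult_left_mono) (auto simp: incseq_def)
  also have "\<dots> = (\<Sum>i\<in>(\<lambda>j. j + n) ` {..<L}. norm (y i) * b i k)"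
    by (subst sum.reindex) (auto simp: inj_on_def)
  also have "\<dots> \<le> kothe_seminorm b k y"
    unfolding kothe_seminorm_def
    by (intro sum_le_suminf kothe_space_summable assms) (auto simp: kothe_matrix_nonneg[OF b])
  finally show ?thesis .
qed

lemma bounded_symbol: "\<exists>S. \<forall>n. norm (\<theta> n) \<le> S"
proof -
  obtain k where k: "0 < b 0 k" using b unfolding kothe_matrix_def by blast
  have "norm (\<theta> n) \<le> kothe_seminorm b k \<theta> / b 0 k" for n
    \<comment> \<open>With \<open>L = 1\<close> only the term
      \<open>norm (\<theta> n) * b 0 k\<close> is left.\<close>
    using sum_shift_le[OF \<theta>, where L=1 and n=n and k=k] k by (simp add: field_simps)
  then show ?thesis by blast
qed

lemma hankel_column_in: "hankel_column \<theta> n \<in> kothe_space b"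
proof -
  have "summable (\<lambda>j. norm (\<theta> (j + n)) * b j k)" for k
  proof (rule bounded_imp_summable)
    show "(\<Sum>j\<le>L. norm (\<theta> (j + n)) * b j k) \<le> kothe_seminorm b k \<theta>" for L
      using sum_shift_le[OF \<theta>, where L="Suc L"] by (simp only: lessThan_Suc_atMost)
  qed (simp add: kothe_matrix_nonneg[OF b])
  then show ?thesis by (simp add: kothe_space_def hankel_column_def)
qed

lemma summable_norm_products:
  assumes "x \<in> kothe_space ell1_matrix"
  shows "summable (\<lambda>n. norm (x n) * norm (\<theta> (j + n)))"
proof -
  obtain S where S: "\<And>n. norm (\<theta> n) \<le> S" using bounded_symbol by blast
  have "summable (\<lambda>n. norm (x n) * S)"
    using kothe_space_summable[OF assms] by (intro summable_mult2) simp
  then show ?thesis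
    by (rule summable_comparison_test'[of _ 0]) (use S in \<open>auto intro: mult_left_mono\<close>)
qed

lemma
  assumes "x \<in> kothe_space ell1_matrix"
  shows summable_products: "summable (\<lambda>n. x n * \<theta> (j + n))"
    and norm_hankel_apply_le: "norm (hankel_apply \<theta> x j) \<le> (\<Sum>n. norm (x n) * norm (\<theta> (j + n)))"
  using summable_norm_le_heine_borel[OF _ summable_norm_products[OF assms, of j], of "\<lambda>n. x n * \<theta> (j + n)"]
  by (simp_all add: norm_mult hankel_apply_def)

text \<open>The main estimate. In rows \<open>j >= J\<close> the operator sees only entries of
  \<open>\<theta>\<close> with index at least \<open>J\<close>, so \<open>\<theta>\<close> may be
  replaced by its tail. Interchanging the sums and applying \<open>sum_shift_le\<close> to that tail
  gives the product bound.\<close>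

lemma seq_tail_hankel_apply:
  assumes x: "x \<in> kothe_space ell1_matrix"
  shows "seq_tail J (hankel_apply \<theta> x) \<in> kothe_space b" (is "?y \<in> _")
    and "kothe_seminorm b k (seq_tail J (hankel_apply \<theta> x))
      \<le> kothe_seminorm ell1_matrix 0 x * kothe_seminorm b k (seq_tail J \<theta>)"
proof -
  let ?t = "seq_tail J \<theta>"
  have t: "?t \<in> kothe_space b" by (rule seq_tail_in_kothe_space[OF b \<theta>])
  have sx: "summable (\<lambda>n. norm (x n))" using kothe_space_summable[OF x] by simp
  have smt: "summable (\<lambda>n. norm (x n) * norm (?t (j + n)))" for j
    by (rule summable_comparison_test'[OF summable_norm_products[OF x, of j], of 0])
       (auto simp: seq_tail_def)
  have smt': "summable (\<lambda>n. norm (x n) * norm (?t (j + n)) * b j l)" for j l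
    by (intro summable_mult2 smt)
  \<comment> \<open>Working with finitely many rows, the interchange is just additivity of
    convergent series; the bound is free of \<open>L\<close> and so gives both summability and the
    seminorm estimate.\<close>
  have bound: "(\<Sum>j<L. norm (?y j) * b j l) \<le> kothe_seminorm ell1_matrix 0 x * kothe_seminorm b l ?t" for L l
  proof -
    have "(\<Sum>j<L. norm (?y j) * b j l) \<le> (\<Sum>j<L. (\<Sum>n. norm (x n) * norm (?t (j + n))) * b j l)"
    proof (intro sum_mono mult_right_mono kothe_matrix_nonneg[OF b])
      fix j
      show "norm (?y j) \<le> (\<Sum>n. norm (x n) * norm (?t (j + n)))"
      proof (cases "j < J")
        case True
        then show ?thesis by (simp add: seq_tail_def suminf_nonneg smt[unfolded seq_tail_def])
      next
        case False
        then show ?thesis using norm_hankel_apply_le[OF x, of j] by (simp add: seq_tail_def)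
      qed
    qed
    also have "\<dots> = (\<Sum>j<L. \<Sum>n. norm (x n) * norm (?t (j + n)) * b j l)"
      by (simp add: suminf_mult2[OF smt])
    also have "\<dots> = (\<Sum>n. \<Sum>j<L. norm (x n) * norm (?t (j + n)) * b j l)"
      by (rule suminf_sum[symmetric, OF smt'])
    also have "\<dots> \<le> (\<Sum>n. norm (x n) * kothe_seminorm b l ?t)"
    proof (rule suminf_le)
      show "(\<Sum>j<L. norm (x n) * norm (?t (j + n)) * b j l) \<le> norm (x n) * kothe_seminorm b l ?t" for n
        using mult_left_mono[OF sum_shift_le[OF t, where L=L and n=n and k=l], of "norm (x n)"]
        by (simp add: sum_distrib_left mult.assoc)
    qed (use smt' sx in \<open>auto intro: summable_sum summable_mult2\<close>)
    also have "\<dots> = kothe_seminorm ell1_matrix 0 x * kothe_seminorm b l ?t"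
      by (simp add: kothe_seminorm_def suminf_mult2[OF sx])
    finally show ?thesis .
  qed
  have sm: "summable (\<lambda>j. norm (?y j) * b j l)" for l
  proof (rule bounded_imp_summable)
    show "(\<Sum>j\<le>L. norm (?y j) * b j l) \<le> kothe_seminorm ell1_matrix 0 x * kothe_seminorm b l ?t" for L
      using bound[where L="Suc L"] by (simp only: lessThan_Suc_atMost)
  qed (simp add: kothe_matrix_nonneg[OF b])
  then show "?y \<in> kothe_space b" by (simp add: kothe_space_def)
  show "kothe_seminorm b k ?y \<le> kothe_seminorm ell1_matrix 0 x * kothe_seminorm b k ?t"
    unfolding kothe_seminorm_def[of b k ?y] by (rule suminf_le_const[OF sm bound])
qed

lemmas hankel_apply_in = seq_tail_hankel_apply(1)[of _ 0, simplified]
lemmas hankel_apply_seminorm_le = seq_tail_hankel_apply(2)[of _ _ 0, simplified]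

text \<open>Truncating the series amounts to applying the operator to a truncation of
  \<open>x\<close>. The error is thus the image of a tail of \<open>x\<close>, and the estimate for
  \<open>hankel_apply\<close> covers it.\<close>

lemma hankel_partial_sum_eq:
  assumes x: "x \<in> kothe_space ell1_matrix"
  shows "hankel_partial_sum \<theta> x N =
    (\<lambda>j. hankel_apply \<theta> x j - hankel_apply \<theta> (seq_tail N x) j)"
proof
  fix j
  let ?f = "\<lambda>n. x n * \<theta> (j + n)"
  let ?g = "\<lambda>n. seq_tail N x n * \<theta> (j + n)"
  have g: "summable ?g"
    by (rule summable_products[OF seq_tail_in_kothe_space[OF kothe_matrix_ell1 x]])
  have "suminf ?g = (\<Sum>n. ?g (n + N)) + (\<Sum>n<N. ?g n)"
    by (rule suminf_split_initial_segment[OF g])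
  also have "\<dots> = (\<Sum>n. ?f (n + N))" by (simp add: seq_tail_def)
  also have "\<dots> = suminf ?f - (\<Sum>n<N. ?f n)"
    by (rule suminf_minus_initial_segment[OF summable_products[OF x]])
  finally show "hankel_partial_sum \<theta> x N j = hankel_apply \<theta> x j - hankel_apply \<theta> (seq_tail N x) j"
    by (simp add: hankel_partial_sum_def hankel_column_def hankel_apply_def)
qed

lemma hankel_partial_sum_in:
  assumes "x \<in> kothe_space ell1_matrix"
  shows "hankel_partial_sum \<theta> x N \<in> kothe_space b"
  unfolding hankel_partial_sum_eq[OF assms]
  by (intro kothe_space_diff b hankel_apply_in seq_tail_in_kothe_space kothe_matrix_ell1 assms)

text \<open>The error has \<open>k\<close>-th seminorm at most the ell^1 norm of the tail of
  \<open>x\<close> times the seminorm of \<open>\<theta>\<close>, and the first factor tends to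
  zero.\<close>

lemma limitin_hankel_partial_sum:
  assumes x: "x \<in> kothe_space ell1_matrix"
  shows "limitin (kothe_topology b) (hankel_partial_sum \<theta> x) (hankel_apply \<theta> x) sequentially"
  unfolding limitin_kothe_topology[OF b hankel_partial_sum_in[OF x]]
proof (intro conjI allI)
  show "hankel_apply \<theta> x \<in> kothe_space b" by (rule hankel_apply_in[OF x])
  fix k
  note tx = seq_tail_in_kothe_space[OF kothe_matrix_ell1 x]
  have eq: "kothe_seminorm b k (\<lambda>i. hankel_partial_sum \<theta> x N i - hankel_apply \<theta> x i)
      = kothe_seminorm b k (hankel_apply \<theta> (seq_tail N x))" for N
    by (simp add: hankel_partial_sum_eq[OF x] kothe_seminorm_def)
  show "(\<lambda>N. kothe_seminorm b k (\<lambda>i. hankel_partial_sum \<theta> x N i - hankel_apply \<theta> x i)) \<longlonglongrightarrow> 0"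
    unfolding eq
  proof (rule tendsto_sandwich[OF _ _ tendsto_const])
    show "(\<lambda>N. kothe_seminorm ell1_matrix 0 (seq_tail N x) * kothe_seminorm b k \<theta>) \<longlonglongrightarrow> 0"
      by (rule tendsto_mult_left_zero[OF kothe_seminorm_seq_tail_tendsto_0[OF kothe_matrix_ell1 x]])
  qed (use hankel_apply_seminorm_le[OF tx] kothe_seminorm_nonneg[OF b hankel_apply_in[OF tx]] in auto)
qed

lemma hankel_eq_apply:
  assumes x: "x \<in> kothe_space ell1_matrix"
  shows "hankel \<theta> b x = hankel_apply \<theta> x"
  unfolding hankel_def
proof (rule the_equality)
  show "limitin (kothe_topology b) (hankel_partial_sum \<theta> x) (hankel_apply \<theta> x) sequentially"
    by (rule limitin_hankel_partial_sum[OF x])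
  then show "y = hankel_apply \<theta> x"
    if "limitin (kothe_topology b) (hankel_partial_sum \<theta> x) y sequentially" for y
    by (rule limitin_kothe_topology_unique[OF b hankel_partial_sum_in[OF x] that])
qed

lemma hankel_apply_add:
  assumes "x \<in> kothe_space ell1_matrix" "y \<in> kothe_space ell1_matrix"
  shows "hankel_apply \<theta> (\<lambda>n. x n + y n) = (\<lambda>j. hankel_apply \<theta> x j + hankel_apply \<theta> y j)"
  by (simp add: hankel_apply_def suminf_add summable_products assms distrib_right)

lemma hankel_apply_scale:
  assumes "x \<in> kothe_space ell1_matrix"
  shows "hankel_apply \<theta> (\<lambda>n. c * x n) = (\<lambda>j. c * hankel_apply \<theta> x j)"
  by (simp add: hankel_apply_def suminf_mult[OF summable_products[OF assms]] mult.assoc)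

section \<open>Continuity and compactness for a general target with increasing weights\<close>

theorem hankel_continuous_compact:
  assumes a: "kothe_matrix a" and C: "0 < C" "\<And>n. C \<le> a n m"
  shows "hankel_well_defined \<theta> a b"
    and "continuous_map (kothe_topology a) (kothe_topology b) (hankel \<theta> b)"
    and "compact_operator (kothe_topology a) (kothe_topology b) (hankel \<theta> b)"
proof -
  note ell1 = kothe_space_subset_ell1[where a=a and C=C and m=m, OF _ C]
  note eq = hankel_eq_apply[OF ell1(1)]
  show "hankel_well_defined \<theta> a b"
    unfolding hankel_well_defined_def
    using hankel_column_in limitin_hankel_partial_sum ell1(1) by blast
  have lin: "linear_map_between (kothe_space a) (kothe_space b) (hankel \<theta> b)"
    unfolding linear_map_between_def
    by (auto simp: eq kothe_space_add(1)[OF a] kothe_space_scale hankel_apply_add hankel_apply_scale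
        ell1(1) hankel_apply_in)
  have tail_bound: "kothe_seminorm b k (seq_tail J (hankel \<theta> b x))
      \<le> kothe_seminorm a m x / C * kothe_seminorm b k (seq_tail J \<theta>)"
    if "x \<in> kothe_space a" for k J x
    using seq_tail_hankel_apply(2)[OF ell1(1)[OF that], of k J]
      mult_right_mono[OF ell1(2)[OF that]
        kothe_seminorm_nonneg[OF b seq_tail_in_kothe_space[OF b \<theta>, of J], of k]]
    by (simp add: eq that)
  show "continuous_map (kothe_topology a) (kothe_topology b) (hankel \<theta> b)"
  proof (rule continuous_map_kothe[OF a b lin])
    fix k
    show "\<exists>l M. \<forall>x\<in>kothe_space a. kothe_seminorm b k (hankel \<theta> b x) \<le> M * kothe_seminorm a l x"
      \<comment> \<open>At \<open>J = 0\<close> the tail is the whole sequence.\<close>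
      using tail_bound[of _ k 0]
      by (intro exI[of _ m] exI[of _ "kothe_seminorm b k \<theta> / C"]) (simp add: mult.commute)
  qed
  \<comment> \<open>One neighborhood serves all target seminorms: on this ball the ell^1 norm is at
    most \<open>1 / C\<close>.\<close>
  let ?U = "kothe_ball a m (\<lambda>n. 0) 1 :: (nat \<Rightarrow> 'a) set"
  have U: "x \<in> kothe_space a" "kothe_seminorm a m x / C \<le> 1 / C" if "x \<in> ?U" for x
    using that C by (auto simp: kothe_ball_def divide_right_mono)
  have nbhd: "zero_neighborhood (kothe_topology a) ?U"
    using openin_kothe_ball[of "\<lambda>n. 0::'a" a 1 m] center_in_kothe_ball[of "\<lambda>n. 0::'a" a 1 m]
    unfolding zero_neighborhood_def by (auto simp: kothe_ball_def)
  have unif: "kothe_seminorm b k (seq_tail J y) \<le> 1 / C * kothe_seminorm b k (seq_tail J \<theta>)"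
    if "y \<in> hankel \<theta> b ` ?U" for y k J
    using that tail_bound U
      mult_right_mono[OF U(2) kothe_seminorm_nonneg[OF b seq_tail_in_kothe_space[OF b \<theta>, of J], of k]]
    by (fastforce intro: order_trans)
  have sub: "hankel \<theta> b ` ?U \<subseteq> kothe_space b"
    using U(1) lin by (auto simp: linear_map_between_def)
  have "precompact_in (kothe_topology b) (hankel \<theta> b ` ?U)"
  proof (rule precompact_in_kothe[OF b sub])
    fix j
    obtain k where k: "0 < b j k" using b unfolding kothe_matrix_def by blast
    have "norm (y j) \<le> 1 / C * kothe_seminorm b k \<theta> / b j k" if y: "y \<in> hankel \<theta> b ` ?U" for y
    proof -
      \<comment> \<open>A single term of a nonnegative series is at most its sum.\<close>
      have "norm (y j) * b j k \<le> kothe_seminorm b k y"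
        unfolding kothe_seminorm_def
        using sum_le_suminf[OF kothe_space_summable, of y b "{j}" k] sub y
        by (auto simp: kothe_matrix_nonneg[OF b])
      also have "\<dots> \<le> 1 / C * kothe_seminorm b k \<theta>" using unif[OF y, of k 0] by simp
      finally show ?thesis by (subst pos_le_divide_eq[OF k])
    qed
    then show "\<exists>R. \<forall>y\<in>hankel \<theta> b ` ?U. norm (y j) \<le> R" by blast
  next
    fix k and e :: real assume "0 < e"
    \<comment> \<open>The bound involves only the tails of \<open>\<theta>\<close>, so one
      \<open>J\<close> works for the whole image.\<close>
    have "(\<lambda>J. 1 / C * kothe_seminorm b k (seq_tail J \<theta>)) \<longlonglongrightarrow> 0"
      by (rule tendsto_mult_right_zero[OF kothe_seminorm_seq_tail_tendsto_0[OF b \<theta>]])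
    then have "eventually (\<lambda>J. 1 / C * kothe_seminorm b k (seq_tail J \<theta>) < e) sequentially"
      using \<open>0 < e\<close> by (rule order_tendstoD)
    then obtain J where "1 / C * kothe_seminorm b k (seq_tail J \<theta>) < e"
      by (auto simp: eventually_sequentially)
    then show "\<exists>J. \<forall>y\<in>hankel \<theta> b ` ?U. kothe_seminorm b k (seq_tail J y) < e"
      using unif[of _ k J] by (intro exI[of _ J]) (auto intro: le_less_trans)
  qed
  with nbhd lin show "compact_operator (kothe_topology a) (kothe_topology b) (hankel \<theta> b)"
    unfolding compact_operator_def by auto
qed

end

section \<open>Specialization to power series spaces of infinite type\<close>

lemma kothe_matrix_power_series:
  assumes "\<And>n. 0 \<le> \<beta> n"
  shows "kothe_matrix (power_series_matrix \<beta>)"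
  using assms by (simp add: kothe_matrix_def power_series_matrix_def mult_right_mono)

lemma incseq_power_series_matrix: "incseq \<beta> \<Longrightarrow> incseq (\<lambda>n. power_series_matrix \<beta> n k)"
  by (simp add: incseq_def power_series_matrix_def mult_left_mono)

theorem proposition3p4:
  fixes a :: "nat \<Rightarrow> nat \<Rightarrow> real"
    and \<beta> :: "nat \<Rightarrow> real"
    and \<theta> :: "nat \<Rightarrow> 'a::{real_normed_field,heine_borel}"
  assumes "kothe_matrix a"
    and "\<forall>n. 0 \<le> \<beta> n"
    and "incseq \<beta>"
    and "filterlim \<beta> at_top sequentially"
    and "\<theta> \<in> kothe_space (power_series_matrix \<beta>)"
    and "\<exists>m0. \<exists>C>0. \<forall>n. a n m0 \<ge> C"
  shows "hankel_well_defined \<theta> a (power_series_matrix \<beta>) \<and>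
    continuous_map (kothe_topology a) (kothe_topology (power_series_matrix \<beta>))
      (hankel \<theta> (power_series_matrix \<beta>)) \<and>
    compact_operator (kothe_topology a) (kothe_topology (power_series_matrix \<beta>))
      (hankel \<theta> (power_series_matrix \<beta>))"
proof -
  \<comment> \<open>Nonnegativity of \<open>\<beta>\<close> makes the weights increase in
    \<open>k\<close>, its monotonicity makes them increase in \<open>n\<close>.\<close>
  interpret hankel_ell1 "power_series_matrix \<beta>" \<theta>
    using assms by unfold_locales (auto intro: kothe_matrix_power_series incseq_power_series_matrix)
  from assms(6) obtain m C where "0 < C" "\<And>n. C \<le> a n m" by blast
  from hankel_continuous_compact[OF assms(1) this] show ?thesis by blast
qed

end
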